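(* For integers $n, m \geq 0$, let $D^e_{2,2}(n, m)$ be the number of partitions of $n$ into $m$ parts $\lambda_1 \leq \cdots \leq \lambda_m$ such that $\lambda_{i+1} - \lambda_i \geq 2$ for all $i$, and $\lambda_{i+1} - \lambda_i \geq 3$ unless $\lambda_i$ and $\lambda_{i+1}$ are both even. Then \[ \sum_{m, n \geq 0} D^e_{2,2}(n, m) q^n x^m = \sum_{n_1, n_2 \geq 0} \frac{ q^{4n_2^2 + 2n_2 + (3n_1^2 + n_1)/2 + 4n_2 n_1} (1 + xq^{4n_2 + 2n_1 + 1}) x^{2n_2 + n_1} }{ (q; q)_{n_1} (q^4; q^4)_{n_2} }. \]
   Context: A partition of $n$ into $m$ parts is a non-decreasing sequence of $m$ positive integers summing to $n$. For $n \geq 0$, $(a; q)_n = \prod_{j=1}^{n} (1 - a q^{j-1})$, with the empty product equal to $1$. *)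

theory Defs
  imports "HOL-Analysis.Analysis" "HOL-Computational_Algebra.Formal_Power_Series"
begin

definition partitions_into :: "nat \<Rightarrow> nat \<Rightarrow> nat list set" where
  "partitions_into n m =
     {xs. sorted xs \<and> (\<forall>k\<in>set xs. 0 < k) \<and> length xs = m \<and> sum_list xs = n}"

definition De22 :: "nat \<Rightarrow> nat \<Rightarrow> nat" where
  "De22 n m = card {xs \<in> partitions_into n m.
     \<forall>i. Suc i < m \<longrightarrow>
       xs ! i + 2 \<le> xs ! Suc i \<and>
       (\<not> (even (xs ! i) \<and> even (xs ! Suc i)) \<longrightarrow> xs ! i + 3 \<le> xs ! Suc i)}"

text \<open>Finiteness, so that \<^const>\<open>card\<close> in \<^const>\<open>De22\<close> is a genuine count.\<close>

lemma finite_partitions_into: "finite (partitions_into n m)"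
proof (rule finite_subset)
  show "partitions_into n m \<subseteq> {xs. set xs \<subseteq> {..n} \<and> length xs = m}"
    by (auto simp: partitions_into_def member_le_sum_list)
  show "finite {xs. set xs \<subseteq> {..n} \<and> length xs = m}"
    by (rule finite_lists_length_eq) simp
qed

definition qpoch :: "'a::comm_ring_1 \<Rightarrow> 'a \<Rightarrow> nat \<Rightarrow> 'a" where
  "qpoch a q n = (\<Prod>j=1..n. 1 - a * q ^ (j - 1))"

text \<open>
  Bivariate formal power series in \<open>q\<close> and \<open>x\<close> are elements of \<^typ>\<open>rat fps fps\<close>: the outer
  variable is \<open>x\<close>, the inner one \<open>q\<close>; the coefficient of \<open>q\<^sup>n x\<^sup>m\<close> in \<open>F\<close> is
  \<open>fps_nth (fps_nth F m) n\<close>.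
\<close>

definition De22_gf :: "rat fps fps" where
  "De22_gf = Abs_fps (\<lambda>m. Abs_fps (\<lambda>n. of_nat (De22 n m)))"

end

theory Submission
  imports Defs
begin

text \<open>
  Let \<open>a\<^sub>m\<close> and \<open>b\<^sub>m\<close> be the generating functions in \<open>q\<close> of the admissible partitions into
  \<open>m\<close> parts with all parts \<open>\<ge> 1\<close> and \<open>\<ge> 2\<close>, respectively. A part following a 1 or a 2 is an
  arbitrary number \<open>\<ge> 4\<close>, and subtracting 2 from every part preserves admissibility. Removing
  the smallest part therefore gives
  \<open>a\<^sub>m = b\<^sub>m + q\<^bsup>2m-1\<^esup> b\<^bsub>m-1\<^esub>\<close> and \<open>b\<^sub>m = q\<^bsup>2m\<^esup> (a\<^sub>m + b\<^bsub>m-1\<^esub>)\<close>, hence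
  \<open>(1 - q\<^bsup>2m\<^esup>) b\<^sub>m = q\<^bsup>2m\<^esup> (1 + q\<^bsup>2m-1\<^esup>) b\<^bsub>m-1\<^esub>\<close>.
  On the other side, the series \<open>C(z) = (-z;q)\<^sub>\<infinity> / (z\<^sup>2;q\<^sup>4)\<^sub>\<infinity>\<close>, expanded by Euler's two
  identities, satisfies \<open>(1 - z) C(z) = (1 + z q) C(z q\<^sup>2)\<close>, so that \<open>q\<^bsup>m(m+1)\<^esup> [z\<^sup>m] C(z)\<close>
  obeys the same recurrence as \<open>b\<^sub>m\<close>. The factor \<open>1 + x q\<^bsup>4n\<^sub>2+2n\<^sub>1+1\<^esup>\<close> accounts for the
  passage from \<open>b\<close> to \<open>a\<close>.
\<close>

section \<open>Admissible partitions\<close>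

definition gap :: "nat \<Rightarrow> nat \<Rightarrow> bool" where
  "gap a b \<longleftrightarrow> a + 2 \<le> b \<and> (\<not> (even a \<and> even b) \<longrightarrow> a + 3 \<le> b)"

definition admissible :: "nat \<Rightarrow> nat \<Rightarrow> nat \<Rightarrow> nat list set" where
  "admissible k n m =
     {xs. successively gap xs \<and> (\<forall>y\<in>set xs. k \<le> y) \<and> length xs = m \<and> sum_list xs = n}"

lemma successively_gap_imp_sorted: "successively gap xs \<Longrightarrow> sorted xs"
  by (rule successively_iff_sorted_wrt_strong[THEN iffD1])
    (auto intro: successively_mono simp: gap_def)

lemma De22_eq_card_admissible: "De22 n m = card (admissible 1 n m)"
proof -
  have "{xs \<in> partitions_into n m.
     \<forall>i. Suc i < m \<longrightarrow>
       xs ! i + 2 \<le> xs ! Suc i \<and>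
       (\<not> (even (xs ! i) \<and> even (xs ! Suc i)) \<longrightarrow> xs ! i + 3 \<le> xs ! Suc i)} =
     admissible 1 n m"
    using successively_gap_imp_sorted
    by (auto simp: partitions_into_def admissible_def successively_conv_nth gap_def Suc_le_eq)
  thus ?thesis
    by (simp add: De22_def)
qed

lemma finite_admissible: "finite (admissible k n m)"
  by (rule finite_subset[OF _ finite_lists_length_eq[of "{..n}" m]])
    (auto simp: admissible_def member_le_sum_list)

text \<open>A difference of 2 is forbidden after 1 by parity but allowed from 2 to 4. So both force
  the next part to be at least 4, and from 4 on every value is allowed. Sortedness extends the bound
  to all later parts.\<close>

lemma successively_gap_Cons_iff:
  assumes "k = 1 \<or> k = 2"
  shows "successively gap (k # xs) \<longleftrightarrow> successively gap xs \<and> (\<forall>y\<in>set xs. 4 \<le> y)"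
proof (cases xs)
  case (Cons b ys)
  have "gap k b \<longleftrightarrow> 4 \<le> b"
  proof -
    have "b = 3 \<Longrightarrow> odd b" by simp
    moreover have "b < 4 \<Longrightarrow> b = 0 \<or> b = 1 \<or> b = 2 \<or> b = 3" by linarith
    ultimately show ?thesis
      using assms by (cases "b < 4"; cases "b = 4") (auto simp: gap_def)
  qed
  moreover have "\<forall>y\<in>set ys. b \<le> y" if "successively gap (b # ys)"
    using successively_gap_imp_sorted[OF that] by simp
  ultimately show ?thesis
    using Cons by fastforce
qed auto

text \<open>Case split on whether the first part equals \<open>k\<close>. The guard
  \<open>n < k\<close> matters: truncated subtraction would otherwise admit \<open>[k]\<close> when
  \<open>m = 0\<close>.\<close>

lemma admissible_split:
  assumes "k = 1 \<or> k = 2"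
  shows "admissible k n (Suc m) =
    admissible (Suc k) n (Suc m) \<union> (if n < k then {} else (#) k ` admissible 4 (n - k) m)"
    (is "_ = _ \<union> ?B")
proof (intro set_eqI)
  fix xs
  show "xs \<in> admissible k n (Suc m) \<longleftrightarrow> xs \<in> admissible (Suc k) n (Suc m) \<union> ?B"
  proof (cases xs)
    case (Cons y ys)
    show ?thesis
    proof (cases "y = k")
      case True
      thus ?thesis
        using assms Cons successively_gap_Cons_iff[OF assms, of ys]
        by (auto simp: admissible_def) (force+)
    next
      case False
      have "\<forall>z\<in>set ys. y \<le> z" if "successively gap xs"
        using successively_gap_imp_sorted[OF that] Cons by simp
      thus ?thesis
        using False Cons by (force simp: admissible_def)
    qed
  qed (auto simp: admissible_def)
qed

lemma card_admissible_split:
  assumes "k = 1 \<or> k = 2"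
  shows "card (admissible k n (Suc m)) =
    card (admissible (Suc k) n (Suc m)) + (if n < k then 0 else card (admissible 4 (n - k) m))"
proof -
  have "k # xs \<notin> admissible (Suc k) n (Suc m)" for xs
    by (simp add: admissible_def)
  hence "admissible (Suc k) n (Suc m) \<inter> (#) k ` admissible 4 (n - k) m = {}"
    by blast
  moreover have "card ((#) k ` admissible 4 (n - k) m) = card (admissible 4 (n - k) m)"
    by (rule card_image) simp
  ultimately show ?thesis
    by (subst admissible_split[OF assms]) (simp add: card_Un_disjoint finite_admissible)
qed

lemma sum_list_map_plus2: "sum_list (map (\<lambda>y. y + 2) xs) = sum_list xs + 2 * length xs"
  for xs :: "nat list"
  by (induction xs) auto

lemma admissible_add2:
  "admissible (k + 2) n m = (if n < 2 * m then {} else map (\<lambda>y. y + 2) ` admissible k (n - 2 * m) m)"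
proof -
  have gap2: "gap (a + 2) (b + 2) = gap a b" for a b
    by (auto simp: gap_def)
  have "xs \<in> map (\<lambda>y. y + 2) ` admissible k (n - 2 * m) m \<and> 2 * m \<le> n"
    if "xs \<in> admissible (k + 2) n m" for xs
  proof -
    \<comment> \<open>All entries are at least \<open>k + 2\<close>, so the truncated subtraction is
      exact and \<open>ys\<close> is a true preimage.\<close>
    define ys where "ys = map (\<lambda>y. y - 2) xs"
    have xs: "xs = map (\<lambda>y. y + 2) ys"
      using that unfolding ys_def map_map
      by (intro map_idI[symmetric]) (force simp: admissible_def)
    have "sum_list xs = sum_list ys + 2 * length ys"
      unfolding xs by (rule sum_list_map_plus2)
    thus ?thesis
      using that unfolding xs
      by (auto simp: admissible_def successively_map gap2 intro!: imageI
          simp del: add_2_eq_Suc add_2_eq_Suc')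
  qed
  moreover have "map (\<lambda>y. y + 2) xs \<in> admissible (k + 2) n m"
    if "xs \<in> admissible k (n - 2 * m) m" "2 * m \<le> n" for xs
    using that sum_list_map_plus2[of xs]
    by (auto simp: admissible_def successively_map gap2 simp del: add_2_eq_Suc add_2_eq_Suc')
  ultimately show ?thesis
    by (auto simp: not_less)
qed

lemma card_admissible_add2:
  "card (admissible (k + 2) n m) = (if n < 2 * m then 0 else card (admissible k (n - 2 * m) m))"
proof -
  have inj: "inj (map (\<lambda>y::nat. y + 2))"
    by (intro inj_mapI) (simp add: inj_def)
  have "card (map (\<lambda>y. y + 2) ` admissible k (n - 2 * m) m) = card (admissible k (n - 2 * m) m)"
    by (rule card_image[OF inj_on_subset[OF inj subset_UNIV]])
  thus ?thesis
    unfolding admissible_add2 by simp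
qed

section \<open>Recurrences for the generating functions in q\<close>

definition admissible_gf :: "nat \<Rightarrow> nat \<Rightarrow> rat fps" where
  "admissible_gf k m = Abs_fps (\<lambda>n. of_nat (card (admissible k n m)))"

lemma admissible_gf_0: "admissible_gf k 0 = 1"
proof -
  have "admissible k n 0 = (if n = 0 then {[]} else {})" for n
    by (auto simp: admissible_def)
  thus ?thesis
    by (auto simp: admissible_gf_def fps_eq_iff)
qed

lemma admissible_gf_split:
  assumes "k = 1 \<or> k = 2"
  shows "admissible_gf k (Suc m) = admissible_gf (Suc k) (Suc m) + fps_X ^ k * admissible_gf 4 m"
  by (rule fps_ext)
    (simp add: admissible_gf_def fps_X_power_mult_nth card_admissible_split[OF assms])

lemma admissible_gf_add2: "admissible_gf (k + 2) m = fps_X ^ (2 * m) * admissible_gf k m"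
  by (rule fps_ext) (simp add: admissible_gf_def fps_X_power_mult_nth card_admissible_add2
      del: add_2_eq_Suc add_2_eq_Suc')

lemma admissible_gf_1_Suc:
  "admissible_gf 1 (Suc m) = admissible_gf 2 (Suc m) + fps_X ^ (2 * m + 1) * admissible_gf 2 m"
proof -
  have "admissible_gf 4 m = fps_X ^ (2 * m) * admissible_gf 2 m"
    using admissible_gf_add2[of 2 m] by simp
  moreover have "admissible_gf 1 (Suc m) = admissible_gf 2 (Suc m) + fps_X ^ 1 * admissible_gf 4 m"
    using admissible_gf_split[of 1 m] by (simp only: Suc_1 simp_thms)
  ultimately show ?thesis
    by (simp add: mult.assoc)
qed

text \<open>The split at 2 leaves \<open>admissible_gf 3\<close>, a shift of
  \<open>admissible_gf 1\<close>; eliminating the latter by \<open>admissible_gf_1_Suc\<close>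
  leaves \<open>admissible_gf 2\<close> alone.\<close>

lemma admissible_gf_2_Suc:
  "(1 - fps_X ^ (2 * m + 2)) * admissible_gf 2 (Suc m) =
     fps_X ^ (2 * m + 2) * (1 + fps_X ^ (2 * m + 1)) * admissible_gf 2 m"
proof -
  have "admissible_gf 2 (Suc m) =
      fps_X ^ (2 * m + 2) * admissible_gf 1 (Suc m) + fps_X ^ (2 * m + 2) * admissible_gf 2 m"
    using admissible_gf_split[of 2 m] admissible_gf_add2[of 2 m] admissible_gf_add2[of 1 "Suc m"]
    by (simp add: numeral_3_eq_3[symmetric] power_add power2_eq_square algebra_simps)
  thus ?thesis
    unfolding admissible_gf_1_Suc by (simp add: algebra_simps)
qed

section \<open>The convolution of Euler's two series\<close>

text \<open>The substitution z -> c z in the series variable z.\<close>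

definition fps_dilate :: "'a \<Rightarrow> 'a fps \<Rightarrow> 'a::comm_ring_1 fps" where
  "fps_dilate c F = Abs_fps (\<lambda>n. c ^ n * fps_nth F n)"

lemma fps_nth_dilate [simp]: "fps_nth (fps_dilate c F) n = c ^ n * fps_nth F n"
  by (simp add: fps_dilate_def)

lemma fps_dilate_mult: "fps_dilate c (F * G) = fps_dilate c F * fps_dilate c G"
proof (rule fps_ext)
  fix n
  have "c ^ n * (fps_nth F i * fps_nth G (n - i)) =
      (c ^ i * fps_nth F i) * (c ^ (n - i) * fps_nth G (n - i))" if "i \<le> n" for i
    using that power_add[of c i "n - i"] by (simp add: algebra_simps)
  thus "fps_nth (fps_dilate c (F * G)) n = fps_nth (fps_dilate c F * fps_dilate c G) n"
    by (simp add: fps_mult_nth sum_distrib_left)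
qed

lemma fps_dilate_1_plus_X: "fps_dilate c (1 + fps_X) = 1 + fps_const c * fps_X"
  by (rule fps_ext) (simp add: fps_X_def)

lemma fps_dilate_dilate: "fps_dilate c (fps_dilate d F) = fps_dilate (c * d) F"
  by (rule fps_ext) (simp add: power_mult_distrib)

lemma qpoch_0 [simp]: "qpoch a q 0 = 1"
  by (simp add: qpoch_def)

lemma qpoch_Suc: "qpoch a q (Suc n) = qpoch a q n * (1 - a * q ^ n)"
  by (simp add: qpoch_def)

lemma qpoch_X_power_nth_0:
  "k > 0 \<Longrightarrow> fps_nth (qpoch (fps_X ^ k) (fps_X ^ k) n :: 'a::field fps) 0 = 1"
  by (cases k; induction n) (simp_all add: qpoch_Suc)

lemma inverse_qpoch_Suc:
  fixes k n :: nat
  assumes "k > 0"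
  defines "Q \<equiv> fps_X ^ k :: 'a::field fps"
  shows "(1 - Q ^ Suc n) * inverse (qpoch Q Q (Suc n)) = inverse (qpoch Q Q n)"
proof -
  have "fps_nth (1 - Q ^ Suc n) 0 \<noteq> 0"
    using assms(1) by (cases k) (simp_all add: Q_def)
  hence "(1 - Q ^ Suc n) * inverse (1 - Q ^ Suc n) = 1"
    by (rule inverse_mult_eq_1')
  moreover have "inverse (qpoch Q Q (Suc n)) = inverse (qpoch Q Q n) * inverse (1 - Q ^ Suc n)"
    by (simp add: qpoch_Suc fps_inverse_mult)
  ultimately show ?thesis
    by (simp only: mult.left_commute mult_1_right)
qed

text \<open>Euler's expansion of (-z;q)_inf, with z the outer and q the inner variable.\<close>

definition euler_series :: "'a::field fps fps" where
  "euler_series = Abs_fps (\<lambda>n. fps_X ^ (n choose 2) * inverse (qpoch fps_X fps_X n))"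

text \<open>Euler's expansion of 1/(z^2;q^4)_inf.\<close>

definition even_euler_series :: "'a::field fps fps" where
  "even_euler_series =
     Abs_fps (\<lambda>n. if even n then inverse (qpoch (fps_X ^ 4) (fps_X ^ 4) (n div 2)) else 0)"

text \<open>Coefficientwise form of (-z;q)_inf = (1 + z) (-zq;q)_inf. At z^(k+1) it reduces to
  cancelling 1 - q^(k+1) in the \<open>qpoch\<close> denominator.\<close>

lemma euler_series_dilate:
  "euler_series = (1 + fps_X) * fps_dilate fps_X (euler_series :: 'a::field fps fps)"
proof (rule fps_ext)
  fix n
  show "fps_nth (euler_series :: 'a fps fps) n =
      fps_nth ((1 + fps_X) * fps_dilate fps_X euler_series) n"
  proof (cases n)
    case (Suc k)
    have choose: "Suc k choose 2 = k + (k choose 2)"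
      by (simp add: numeral_2_eq_2)
    have "fps_nth (euler_series :: 'a fps fps) (Suc k) * (1 - fps_X ^ Suc k) =
        fps_X ^ k * fps_X ^ (k choose 2) *
        ((1 - fps_X ^ Suc k) * inverse (qpoch fps_X fps_X (Suc k)))"
      by (simp add: euler_series_def choose power_add mult_ac del: power_Suc)
    also have "(1 - fps_X ^ Suc k) * inverse (qpoch fps_X fps_X (Suc k)) =
        inverse (qpoch fps_X fps_X k :: 'a fps)"
      using inverse_qpoch_Suc[of 1 k, where ?'a = 'a] by simp
    finally have "fps_nth (euler_series :: 'a fps fps) (Suc k) * (1 - fps_X ^ Suc k) =
        fps_X ^ k * fps_nth euler_series k"
      by (simp add: euler_series_def mult.assoc)
    thus ?thesis
      using Suc by (simp add: distrib_right algebra_simps)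
  qed (simp add: distrib_right)
qed

text \<open>Replacing z by q^2 z turns z^2 into q^4 z^2, which drops the first factor of
  (z^2;q^4)_inf.\<close>

lemma even_euler_series_dilate:
  "(1 - fps_X ^ 2) * even_euler_series =
     fps_dilate (fps_X ^ 2) (even_euler_series :: 'a::field fps fps)"
proof (rule fps_ext)
  fix n
  have step: "fps_nth (even_euler_series :: 'a fps fps) (n + 2) * (1 - fps_X ^ (2 * (n + 2))) =
        fps_nth even_euler_series n" for n
  proof (cases "even n")
    case True
    then obtain k where k: "n = 2 * k" by blast
    have "n + 2 = 2 * Suc k" "2 * (2 * Suc k) = 4 * Suc k"
      using k by simp_all
    moreover have "(1 - fps_X ^ (4 * Suc k)) * inverse (qpoch (fps_X ^ 4) (fps_X ^ 4) (Suc k)) =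
        inverse (qpoch (fps_X ^ 4) (fps_X ^ 4) k :: 'a fps)"
      using inverse_qpoch_Suc[of 4 k, where ?'a = 'a] by (simp only: power_mult)
    ultimately show ?thesis
      by (simp only: k) (simp add: even_euler_series_def mult.commute del: mult_Suc_right power_Suc)
  qed (simp add: even_euler_series_def)
  show "fps_nth ((1 - fps_X ^ 2) * even_euler_series :: 'a fps fps) n =
      fps_nth (fps_dilate (fps_X ^ 2) even_euler_series) n"
  proof (cases "n < 2")
    case True
    hence "n = 0 \<or> n = 1" by auto
    thus ?thesis
      by (auto simp: left_diff_distrib fps_X_power_mult_nth even_euler_series_def)
  next
    case False
    then obtain k where k: "n = k + 2"
      by (metis le_Suc_ex not_less add.commute)
    let ?E = "fps_nth (even_euler_series :: 'a fps fps)"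
    have "fps_nth ((1 - fps_X ^ 2) * even_euler_series) n = ?E (k + 2) - ?E k"
      by (simp add: k left_diff_distrib fps_X_power_mult_nth)
    also have "\<dots> = (fps_X ^ 2) ^ (k + 2) * ?E (k + 2)"
      unfolding step[of k, symmetric] power_mult by (simp only: algebra_simps mult_1_right mult_1_left)
    finally show ?thesis
      by (simp only: k fps_nth_dilate)
  qed
qed

definition euler_conv :: "nat \<Rightarrow> 'a::field fps" where
  "euler_conv m = fps_nth (euler_series * even_euler_series) m"

lemma euler_conv_0: "euler_conv 0 = 1"
  by (simp add: euler_conv_def euler_series_def even_euler_series_def binomial_eq_0)

text \<open>Two uses of \<open>euler_series_dilate\<close> give P(z) = (1 + z)(1 + zq) P(q^2 z).
  After multiplication with \<open>even_euler_series_dilate\<close>, the factor 1 + z of 1 - z^2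
  cancels.\<close>

lemma euler_product_dilate:
  defines "C \<equiv> euler_series * even_euler_series :: 'a::field fps fps"
  shows "(1 - fps_X) * C = (1 + fps_const fps_X * fps_X) * fps_dilate (fps_X ^ 2) C"
proof -
  let ?P = "euler_series :: 'a fps fps" and ?R = "even_euler_series :: 'a fps fps"
  have "fps_dilate fps_X ?P = fps_dilate fps_X ((1 + fps_X) * fps_dilate fps_X ?P)"
    by (rule arg_cong[OF euler_series_dilate])
  hence dilate_X:
    "fps_dilate fps_X ?P = (1 + fps_const fps_X * fps_X) * fps_dilate (fps_X ^ 2) ?P"
    by (simp add: fps_dilate_mult fps_dilate_1_plus_X fps_dilate_dilate power2_eq_square)
  have "?P = (1 + fps_X) * ((1 + fps_const fps_X * fps_X) * fps_dilate (fps_X ^ 2) ?P)"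
    by (rule euler_series_dilate[where ?'a = 'a, unfolded dilate_X])
  hence "(1 + fps_X) * ((1 - fps_X) * C) =
      (1 + fps_X) * ((1 + fps_const fps_X * fps_X) * fps_dilate (fps_X ^ 2) ?P) *
      ((1 - fps_X ^ 2) * ?R)"
    by (simp add: C_def power2_eq_square algebra_simps)
  also have "\<dots> = (1 + fps_X) * ((1 + fps_const fps_X * fps_X) * fps_dilate (fps_X ^ 2) C)"
    by (simp add: even_euler_series_dilate C_def fps_dilate_mult mult.assoc)
  finally have *: "(1 + fps_X) * ((1 - fps_X) * C) =
    (1 + fps_X) * ((1 + fps_const fps_X * fps_X) * fps_dilate (fps_X ^ 2) C)" .
  have "fps_nth (1 + fps_X :: 'a fps fps) 0 \<noteq> 0"
    by simp
  hence "(1 + fps_X :: 'a fps fps) \<noteq> 0"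
    by (metis fps_zero_nth)
  with * show ?thesis
    by simp
qed

text \<open>Coefficient of z^(m+1) in \<open>euler_product_dilate\<close>: the dilation contributes
  q^(2m+2) at degree m+1 and, with the extra q, q^(2m+1) at degree m.\<close>

lemma euler_conv_Suc:
  "(1 - fps_X ^ (2 * m + 2)) * euler_conv (Suc m) =
     (1 + fps_X ^ (2 * m + 1)) * (euler_conv m :: 'a::field fps)"
  using arg_cong[OF euler_product_dilate[where ?'a = 'a], of "\<lambda>F. fps_nth F (Suc m)"]
  by (simp add: euler_conv_def[symmetric] left_diff_distrib distrib_right mult.assoc
      power_mult[symmetric] algebra_simps)
    (simp add: power2_eq_square mult_ac)

text \<open>The exponent m^2 + m is the sum of 2j for j \<le> m; it collects the factors q^(2j) by
  which the two recurrences differ.\<close>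

lemma admissible_gf_2_eq: "admissible_gf 2 m = fps_X ^ (m\<^sup>2 + m) * euler_conv m"
proof (induction m)
  case 0
  show ?case by (simp add: admissible_gf_0 euler_conv_0)
next
  case (Suc m)
  let ?u = "1 - fps_X ^ (2 * m + 2) :: rat fps"
  have "?u * admissible_gf 2 (Suc m) =
      fps_X ^ (2 * m + 2) * fps_X ^ (m\<^sup>2 + m) * ((1 + fps_X ^ (2 * m + 1)) * euler_conv m)"
    unfolding admissible_gf_2_Suc Suc.IH by (simp only: mult_ac)
  also have "\<dots> = ?u * (fps_X ^ (2 * m + 2 + (m\<^sup>2 + m)) * euler_conv (Suc m))"
    unfolding euler_conv_Suc[symmetric] by (simp only: power_add mult_ac)
  also have "2 * m + 2 + (m\<^sup>2 + m) = (Suc m)\<^sup>2 + Suc m"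
    by (simp add: power2_eq_square)
  finally have *: "?u * admissible_gf 2 (Suc m) =
    ?u * (fps_X ^ ((Suc m)\<^sup>2 + Suc m) * euler_conv (Suc m))" .
  have "fps_nth ?u 0 \<noteq> 0"
    by simp
  hence "?u \<noteq> 0"
    by (metis fps_zero_nth)
  with * show ?case
    by simp
qed

section \<open>The double sum\<close>

definition level :: "nat \<Rightarrow> (nat \<times> nat) set" where
  "level m = {(n1, n2). 2 * n2 + n1 = m}"

lemma finite_level: "finite (level m)"
  by (rule finite_subset[of _ "{..m} \<times> {..m}"]) (auto simp: level_def)

definition summand :: "nat \<times> nat \<Rightarrow> rat fps" where
  "summand = (\<lambda>(n1, n2).
     fps_X ^ (4 * n2\<^sup>2 + 2 * n2 + (3 * n1\<^sup>2 + n1) div 2 + 4 * n2 * n1)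
       / (qpoch fps_X fps_X n1 * qpoch (fps_X ^ 4) (fps_X ^ 4) n2))"

text \<open>Separates a part depending only on m = 2 n2 + n1, the prefactor in
  \<open>admissible_gf_2_eq\<close>, from the exponent in \<open>euler_series\<close>.\<close>

lemma summand_exponent:
  fixes n1 n2 :: nat
  shows "4 * n2\<^sup>2 + 2 * n2 + (3 * n1\<^sup>2 + n1) div 2 + 4 * n2 * n1 =
    ((2 * n2 + n1)\<^sup>2 + (2 * n2 + n1)) + (n1 choose 2)"
proof -
  have "(3 * n1\<^sup>2 + n1) div 2 = n1\<^sup>2 + n1 + (n1 choose 2)"
  proof (induction n1)
    case (Suc k)
    have "3 * (Suc k)\<^sup>2 + Suc k = 3 * k\<^sup>2 + k + 2 * (3 * k + 2)"
      by (simp add: power2_eq_square)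
    hence "(3 * (Suc k)\<^sup>2 + Suc k) div 2 = (3 * k\<^sup>2 + k) div 2 + (3 * k + 2)"
      by simp
    with Suc.IH show ?case
      by (simp add: power2_eq_square numeral_2_eq_2)
  qed simp
  thus ?thesis
    by (simp add: power2_eq_square algebra_simps)
qed

lemma summand_eq:
  "summand (n1, n2) = fps_X ^ ((2 * n2 + n1)\<^sup>2 + (2 * n2 + n1)) *
     (fps_nth euler_series n1 * fps_nth even_euler_series (2 * n2))"
  using qpoch_X_power_nth_0[of 1 n1, where ?'a = rat] qpoch_X_power_nth_0[of 4 n2, where ?'a = rat]
  unfolding summand_def summand_exponent prod.case
  by (simp add: fps_divide_unit fps_inverse_mult euler_series_def even_euler_series_def
      power_add mult_ac)

text \<open>The sum is a Cauchy product coefficient: only indices i with m - i even survive, and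
  each determines n2 = (m - i)/2.\<close>

lemma sum_summand_level: "sum summand (level m) = admissible_gf 2 m"
proof -
  let ?f = "\<lambda>i. fps_nth euler_series i * fps_nth even_euler_series (m - i) :: rat fps"
  have "euler_conv m = (\<Sum>i=0..m. ?f i)"
    by (simp add: euler_conv_def fps_mult_nth)
  also have "\<dots> = sum ?f (fst ` level m)"
  proof (rule sum.mono_neutral_right)
    show "\<forall>i\<in>{0..m} - fst ` level m. ?f i = 0"
    proof
      fix i assume i: "i \<in> {0..m} - fst ` level m"
      have "odd (m - i)"
      proof
        assume "even (m - i)"
        then obtain j where "m - i = 2 * j" by blast
        with i have "(i, j) \<in> level m" by (auto simp: level_def)
        with i show False by force
      qed
      thus "?f i = 0" by (simp add: even_euler_series_def)
    qed
  qed (auto simp: level_def)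
  also have "\<dots> = (\<Sum>p\<in>level m. fps_nth euler_series (fst p) * fps_nth even_euler_series (2 * snd p))"
    by (subst sum.reindex) (auto simp: inj_on_def level_def intro!: sum.cong)
  finally have "fps_X ^ (m\<^sup>2 + m) * euler_conv m = sum summand (level m)"
    by (auto simp: sum_distrib_left level_def summand_eq intro!: sum.cong)
  thus ?thesis
    by (simp add: admissible_gf_2_eq)
qed

theorem theorem15:
  shows "let q = (fps_X :: rat fps); x = (fps_X :: rat fps fps) in
    ((\<lambda>(n1, n2).
        fps_const (q ^ (4 * n2\<^sup>2 + 2 * n2 + (3 * n1\<^sup>2 + n1) div 2 + 4 * n2 * n1)
                   / (qpoch q q n1 * qpoch (q ^ 4) (q ^ 4) n2))
        * (1 + x * fps_const (q ^ (4 * n2 + 2 * n1 + 1)))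
        * x ^ (2 * n2 + n1))
      has_sum De22_gf) (UNIV :: (nat \<times> nat) set)"
proof -
  define F :: "nat \<times> nat \<Rightarrow> rat fps fps" where "F = (\<lambda>(n1, n2).
      fps_const (summand (n1, n2)) * (1 + fps_X * fps_const (fps_X ^ (4 * n2 + 2 * n1 + 1)))
        * fps_X ^ (2 * n2 + n1))"
  \<comment> \<open>As 4 n2 + 2 n1 + 1 = 2 (2 n2 + n1) + 1, the x-term of the middle factor carries
    the same power of q along a whole level, and moves level m - 1 into degree m.\<close>
  have F_nth: "fps_nth (F p) m =
      (if p \<in> level m then summand p else 0) +
      (if m > 0 \<and> p \<in> level (m - 1) then fps_X ^ (2 * (m - 1) + 1) * summand p else 0)" for p m
  proof (cases p)
    case (Pair n1 n2)
    have "F p = fps_const (summand p) * fps_X ^ (2 * n2 + n1)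
       + fps_const (fps_X ^ (2 * (2 * n2 + n1) + 1) * summand p) * fps_X ^ Suc (2 * n2 + n1)"
      by (simp add: F_def Pair algebra_simps flip: fps_const_mult)
    thus ?thesis
      by (auto simp: fps_X_power_nth level_def Pair simp del: power_Suc)
  qed
  \<comment> \<open>Checked per power of x, each of which receives only finitely many nonzero
    terms.\<close>
  have "(F has_sum De22_gf) UNIV"
  proof (rule has_sum_fpsI)
    fix m
    let ?T = "level m \<union> level (m - 1)"
    have T: "{p \<in> UNIV. fps_nth (F p) m \<noteq> 0} \<subseteq> ?T"
      by (auto simp: F_nth split: if_splits)
    show "finite {p \<in> UNIV. fps_nth (F p) m \<noteq> 0}"
      by (rule finite_subset[OF T]) (simp add: finite_level)
    have "(\<Sum>p | p \<in> UNIV \<and> fps_nth (F p) m \<noteq> 0. fps_nth (F p) m) = (\<Sum>p\<in>?T. fps_nth (F p) m)"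
      using T by (intro sum.mono_neutral_left) (auto simp: finite_level)
    also have "\<dots> = (\<Sum>p\<in>level m. summand p) +
        (if m > 0 then fps_X ^ (2 * (m - 1) + 1) * (\<Sum>p\<in>level (m - 1). summand p) else 0)"
    proof -
      have "(\<Sum>p\<in>?T. if p \<in> level k then h p else 0) = sum h (level k)"
        if "k = m \<or> k = m - 1" for k and h :: "nat \<times> nat \<Rightarrow> rat fps"
        using that by (intro sum.mono_neutral_cong_right) (auto simp: finite_level)
      thus ?thesis
        by (cases "m > 0") (simp_all add: F_nth sum.distrib sum_distrib_left)
    qed
    \<comment> \<open>For m > 0 this is \<open>admissible_gf_1_Suc\<close>; for m = 0 only the first
      sum remains, and both sides are 1.\<close>
    also have "\<dots> = admissible_gf 1 m"
      by (cases m) (simp_all add: sum_summand_level admissible_gf_0 admissible_gf_1_Suc[simplified])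
    also have "\<dots> = fps_nth De22_gf m"
      by (simp add: De22_gf_def admissible_gf_def De22_eq_card_admissible)
    finally show "fps_nth De22_gf m =
        (\<Sum>p | p \<in> UNIV \<and> fps_nth (F p) m \<noteq> 0. fps_nth (F p) m)" ..
  qed
  thus ?thesis
    by (simp add: F_def summand_def Let_def)
qed

end
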